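(* Let $\alpha\in\{231,312\}$ and let $i_n^k(\emptyset;\alpha)$ be the number of involutions of $\{1,\dots,n\}$ with exactly $k$ fixed points that contain the pattern $\alpha$ exactly once. For $n\geq 4$ and $0\leq k\leq n$, $$i_n^k(\emptyset;\alpha)=\begin{cases}(k-1)2^{\frac{n-k-6}{2}}\left(\binom{\frac{n+k}{2}-2}{\frac{n-k}{2}-1}+2\binom{\frac{n+k}{2}-3}{\frac{n-k}{2}-1}+\binom{\frac{n+k}{2}-4}{\frac{n-k}{2}-1}\right) & \text{if } n+k \text{ is even},\\ 0 & \text{if } n+k \text{ is odd}.\end{cases}$$
   Context: An involution is a permutation with $\pi^{-1}=\pi$; a fixed point is an $i$ with $\pi_i=i$. An occurrence of a pattern $\alpha\in S_m$ in $\pi\in S_n$ (one-line notation) is a set of indices $i_1<\dots<i_m$ such that $\pi_{i_1}\cdots\pi_{i_m}$ is order-isomorphic to $\alpha$; $\pi$ contains $\alpha$ exactly once if there is exactly one such occurrence. Binomial coefficients $\binom{a}{b}$ with integers $a,b$ are taken as $1$ if $b=0$ (for every integer $a$, including negative $a$) and $0$ if $b<0$ or $b>0$ with $b>a$. *)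

theory Defs
  imports Complex_Main "HOL-Combinatorics.Permutations"
begin

text \<open>
  A permutation of \<open>{1..n}\<close> is a function \<open>\<pi>\<close> with \<open>\<pi> permutes {1..n}\<close> (hence the identity
  outside \<open>{1..n}\<close>). A pattern is a list in one-line notation, so 231 is \<open>[2, 3, 1]\<close>.
\<close>

definition involutions :: "nat \<Rightarrow> (nat \<Rightarrow> nat) set" where
  "involutions n = {\<pi>. \<pi> permutes {1..n} \<and> inv \<pi> = \<pi>}"

definition fixed_points :: "nat \<Rightarrow> (nat \<Rightarrow> nat) \<Rightarrow> nat set" where
  "fixed_points n \<pi> = {i \<in> {1..n}. \<pi> i = i}"

definition order_isomorphic :: "nat list \<Rightarrow> nat list \<Rightarrow> bool" where
  "order_isomorphic xs ys \<longleftrightarrow> length xs = length ys \<and>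
     (\<forall>i<length xs. \<forall>j<length xs. xs ! i < xs ! j \<longleftrightarrow> ys ! i < ys ! j)"

text \<open>
  For an index set \<open>I = {i\<^sub>1 < \<dots> < i\<^sub>m}\<close>, the list below is
  \<open>[\<pi> i\<^sub>1, \<dots>, \<pi> i\<^sub>m]\<close>; equality of the lengths forces \<open>m = length \<alpha>\<close>.
\<close>

definition occurrences :: "nat \<Rightarrow> nat list \<Rightarrow> (nat \<Rightarrow> nat) \<Rightarrow> nat set set" where
  "occurrences n \<alpha> \<pi> =
     {I. I \<subseteq> {1..n} \<and> order_isomorphic (map \<pi> (sorted_list_of_set I)) \<alpha>}"

definition contains_exactly_once :: "nat \<Rightarrow> nat list \<Rightarrow> (nat \<Rightarrow> nat) \<Rightarrow> bool" where
  "contains_exactly_once n \<alpha> \<pi> \<longleftrightarrow> card (occurrences n \<alpha> \<pi>) = 1"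

definition num_inv_once :: "nat \<Rightarrow> nat \<Rightarrow> nat list \<Rightarrow> nat" where
  "num_inv_once n k \<alpha> =
     card {\<pi> \<in> involutions n. card (fixed_points n \<pi>) = k \<and> contains_exactly_once n \<alpha> \<pi>}"

text \<open>
  Binomial coefficients with integer arguments. Note that, in contrast to \<open>(gchoose)\<close>,
  a negative upper argument gives 0 whenever the lower argument is positive.
\<close>

definition int_binomial :: "int \<Rightarrow> int \<Rightarrow> nat" where
  "int_binomial a b =
     (if b = 0 then 1 else if b < 0 \<or> b > a then 0 else nat a choose nat b)"

end

theory Submission
  imports Defs "HOL-Computational_Algebra.Polynomial" "HOL-Computational_Algebra.Formal_Power_Series"
begin

text \<open>
  Let \<open>\<pi>\<close> be an involution of \<open>{c+1..n}\<close> with at most one occurrence of 231 and put \<open>b = \<pi> (c+1)\<close>.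
  Then \<open>\<pi>\<close> preserves \<open>{c+1..b}\<close>, as \<open>x < b < \<pi> x\<close> would give the two occurrences
  at \<open>(c+1, x, b)\<close> and \<open>(c+1, x, \<pi> x)\<close>. Since \<open>\<pi> b = c+1\<close> is the smallest value, every ascending pair
  in front of \<open>b\<close> yields an occurrence of 231. So this first block is decreasing, or it has exactly
  one ascending pair, and then the involution property forces it to be 4231. Hence the involutions
  containing 231 once are the direct sums of decreasing blocks with one extra block 4231.

  In the number \<open>d = (n - k) / 2\<close> of transpositions, this gives the generating functions
  \<open>(1 - y) / (1 - 2y)^(k+1)\<close> for the involutions with \<open>k\<close> fixed points avoiding 231, and
  \<open>(k - 1) y (1 - y)^2 / (1 - 2y)^k\<close> for those containing it once, if \<open>k \<ge> 1\<close>. The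
  three binomial coefficients come from rewriting \<open>[y^e] (1 - y)^2 / (1 - 2y)^k\<close> by Pascal's rule.
\<close>

text \<open>Positions are not confined to a carrier, so that the set makes sense for a permutation
  and for its summands alike; \<open>pat231_bounds\<close> locates the occurrences.\<close>

definition pat231 :: "(nat \<Rightarrow> nat) \<Rightarrow> (nat \<times> nat \<times> nat) set" where
  "pat231 \<pi> = {(i, j, l). i < j \<and> j < l \<and> \<pi> l < \<pi> i \<and> \<pi> i < \<pi> j}"

text \<open>
  The carrier \<open>{c<..n}\<close> with varying \<open>c\<close> allows blocks to be removed from the bottom without
  re-indexing the remaining permutation.
\<close>

definition inv231 :: "nat \<Rightarrow> nat \<Rightarrow> nat \<Rightarrow> (nat \<Rightarrow> nat) set" where
  "inv231 c n j = {\<pi>. \<pi> permutes {c<..n} \<and> (\<forall>x. \<pi> (\<pi> x) = x) \<and> card (pat231 \<pi>) = j}"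

definition fixpts :: "nat \<Rightarrow> nat \<Rightarrow> (nat \<Rightarrow> nat) \<Rightarrow> nat set" where
  "fixpts c n \<pi> = {i \<in> {c<..n}. \<pi> i = i}"

definition fix_poly :: "nat \<Rightarrow> nat \<Rightarrow> nat \<Rightarrow> real poly" where
  "fix_poly c n j = (\<Sum>\<pi>\<in>inv231 c n j. monom 1 (card (fixpts c n \<pi>)))"

text \<open>The reversal of \<open>{c<..b}\<close>, that is, the decreasing block.\<close>

definition rev_on :: "nat \<Rightarrow> nat \<Rightarrow> nat \<Rightarrow> nat" where
  "rev_on c b x = (if c < x \<and> x \<le> b then c + b + 1 - x else x)"

section \<open>Permutations of intervals and the location of occurrences\<close>

lemma involution_permutes:
  assumes "\<And>x. p (p x) = x" and "\<And>x. x \<notin> S \<Longrightarrow> p x = x"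
  shows "p permutes S"
  unfolding permutes_def using assms by metis

lemma permutes_interval_le:
  assumes "(\<pi>::nat \<Rightarrow> nat) permutes {c<..b}" shows "\<pi> x \<le> b \<longleftrightarrow> x \<le> b"
  using permutes_in_image[OF assms, of x] permutes_not_in[OF assms, of x]
  by (cases "x \<in> {c<..b}") auto

lemma permutes_interval_gt:
  assumes "(\<pi>::nat \<Rightarrow> nat) permutes {c<..b}" shows "c < \<pi> x \<longleftrightarrow> c < x"
  using permutes_in_image[OF assms, of x] permutes_not_in[OF assms, of x]
  by (cases "x \<in> {c<..b}") auto

text \<open>A point at or below \<open>c\<close> is fixed and smaller than all later values, so it
  cannot play the 2. Dually, a point above \<open>n\<close> is fixed and larger than all earlier
  values, so it cannot play the 1.\<close>

lemma pat231_bounds: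
  assumes p: "\<pi> permutes {c<..n}" and m: "(i, j, l) \<in> pat231 \<pi>"
  shows "c < i" and "l \<le> n"
proof -
  have a: "i < j" "j < l" "\<pi> l < \<pi> i" "\<pi> i < \<pi> j" using m by (auto simp: pat231_def)
  show "c < i"
  proof (rule ccontr)
    assume "\<not> c < i"
    then have "\<pi> i = i" "i \<le> c" using permutes_not_in[OF p, of i] by auto
    moreover have "\<pi> l \<ge> i"
      using permutes_interval_gt[OF p, of l] permutes_not_in[OF p, of l] calculation a
      by (cases "c < l") auto
    ultimately show False using a by simp
  qed
  show "l \<le> n"
  proof (rule ccontr)
    assume "\<not> l \<le> n"
    then have "\<pi> l = l" "n < l" using permutes_not_in[OF p, of l] by auto
    moreover have "\<pi> i \<le> l"
      using permutes_interval_le[OF p, of i] permutes_not_in[OF p, of i] calculation a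
      by (cases "i \<le> n") auto
    ultimately show False using a by simp
  qed
qed

lemma finite_pat231:
  assumes p: "\<pi> permutes {c<..n}" shows "finite (pat231 \<pi>)"
proof (rule finite_subset)
  show "pat231 \<pi> \<subseteq> {..n} \<times> {..n} \<times> {..n}"
    using pat231_bounds(2)[OF p] by (fastforce simp: pat231_def)
qed auto

subsection \<open>Direct sums and the first block\<close>

text \<open>For consecutive carriers, composition is the direct sum; this is how blocks are glued
  below.\<close>

lemma direct_sum_eq:
  assumes b: "(\<beta>::nat \<Rightarrow> nat) permutes {c<..b}" and t: "\<tau> permutes {b<..n}"
  shows "x \<le> b \<Longrightarrow> (\<beta> \<circ> \<tau>) x = \<beta> x" "b < x \<Longrightarrow> (\<beta> \<circ> \<tau>) x = \<tau> x"
  using permutes_not_in[OF t, of x] permutes_not_in[OF b, of "\<tau> x"] permutes_interval_gt[OF t, of x]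
  by auto

text \<open>No occurrence straddles \<open>b\<close>: its last value is below its first, while
  values beyond \<open>b\<close> exceed all values up to \<open>b\<close>. Hence numbers of
  occurrences add up.\<close>

lemma pat231_direct_sum:
  assumes b: "\<beta> permutes {c<..b}" and t: "\<tau> permutes {b<..n}"
  shows "pat231 (\<beta> \<circ> \<tau>) = pat231 \<beta> \<union> pat231 \<tau>" (is "?L = ?R")
    and "pat231 \<beta> \<inter> pat231 \<tau> = {}"
proof -
  note eq = direct_sum_eq[OF b t]
  note le = permutes_interval_le[OF b] and gt = permutes_interval_gt[OF t]
  show "?L = ?R"
  proof (intro subset_antisym subrelI subsetI; clarify)
    fix i j l assume m: "(i, j, l) \<in> pat231 (\<beta> \<circ> \<tau>)" and n: "(i, j, l) \<notin> pat231 \<tau>"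
    have a: "i < j" "j < l" "(\<beta> \<circ> \<tau>) l < (\<beta> \<circ> \<tau>) i" "(\<beta> \<circ> \<tau>) i < (\<beta> \<circ> \<tau>) j"
      using m unfolding pat231_def by blast+
    show "(i, j, l) \<in> pat231 \<beta>"
    proof (cases "l \<le> b")
      case True
      then show ?thesis using a eq(1)[of i] eq(1)[of j] eq(1)[of l] by (simp add: pat231_def)
    next
      case False
      then have "b < i" using a eq(2)[of l] gt[of l] eq(1)[of i] le[of i] by linarith
      then show ?thesis using n a eq(2)[of i] eq(2)[of j] eq(2)[of l] by (simp add: pat231_def)
    qed
  next
    fix i j l assume m: "(i, j, l) \<in> ?R"
    show "(i, j, l) \<in> ?L"
    proof (cases "(i, j, l) \<in> pat231 \<beta>")
      case True
      then show ?thesis using pat231_bounds(2)[OF b True] eq(1)[of i] eq(1)[of j] eq(1)[of l]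
        by (simp add: pat231_def)
    next
      case False
      then have T: "(i, j, l) \<in> pat231 \<tau>" using m by simp
      then show ?thesis using pat231_bounds(1)[OF t T] eq(2)[of i] eq(2)[of j] eq(2)[of l]
        by (simp add: pat231_def)
    qed
  qed
  show "pat231 \<beta> \<inter> pat231 \<tau> = {}"
  proof (intro equals0I; clarify)
    fix i j l assume "(i, j, l) \<in> pat231 \<beta>" "(i, j, l) \<in> pat231 \<tau>"
    then show False using pat231_bounds(2)[OF b, of i j l] pat231_bounds(1)[OF t, of i j l]
      by (simp add: pat231_def)
  qed
qed

lemma direct_sum_inv231:
  assumes b: "\<beta> permutes {c<..b}" "\<And>x. \<beta> (\<beta> x) = x" "card (pat231 \<beta>) = s"
    and t: "\<tau> \<in> inv231 b n j" and "c \<le> b" "b \<le> n"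
  shows "\<beta> \<circ> \<tau> \<in> inv231 c n (s + j)"
    and "card (fixpts c n (\<beta> \<circ> \<tau>)) = card (fixpts c b \<beta>) + card (fixpts b n \<tau>)"
proof -
  have t1: "\<tau> permutes {b<..n}" "\<And>x. \<tau> (\<tau> x) = x" "card (pat231 \<tau>) = j"
    using t by (auto simp: inv231_def)
  note eq = direct_sum_eq[OF b(1) t1(1)]
  note le = permutes_interval_le[OF b(1)] and gt = permutes_interval_gt[OF t1(1)]
  have "\<beta> permutes {c<..n}" "\<tau> permutes {c<..n}"
    using b(1) t1(1) assms(5,6) by (auto intro: permutes_subset)
  then have "\<beta> \<circ> \<tau> permutes {c<..n}" by (rule permutes_compose[rotated])
  moreover have "(\<beta> \<circ> \<tau>) ((\<beta> \<circ> \<tau>) x) = x" for x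
  proof (cases "x \<le> b")
    case True
    then show ?thesis using eq(1)[of x] eq(1)[of "\<beta> x"] le[of x] b(2) by simp
  next
    case False
    then show ?thesis using eq(2)[of x] eq(2)[of "\<tau> x"] gt[of x] t1(2) by simp
  qed
  moreover have "card (pat231 (\<beta> \<circ> \<tau>)) = s + j"
    using pat231_direct_sum[OF b(1) t1(1)] finite_pat231[OF b(1)] finite_pat231[OF t1(1)] b(3) t1(3)
    by (simp add: card_Un_disjoint)
  ultimately show "\<beta> \<circ> \<tau> \<in> inv231 c n (s + j)" unfolding inv231_def by blast
  have "fixpts c n (\<beta> \<circ> \<tau>) = fixpts c b \<beta> \<union> fixpts b n \<tau>"
  proof (rule set_eqI)
    fix x show "x \<in> fixpts c n (\<beta> \<circ> \<tau>) \<longleftrightarrow> x \<in> fixpts c b \<beta> \<union> fixpts b n \<tau>"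
      using eq[of x] assms(5,6) unfolding fixpts_def by (cases "x \<le> b") auto
  qed
  moreover have "fixpts c b \<beta> \<inter> fixpts b n \<tau> = {}" "finite (fixpts c b \<beta>)" "finite (fixpts b n \<tau>)"
    by (auto simp: fixpts_def)
  ultimately show "card (fixpts c n (\<beta> \<circ> \<tau>)) = card (fixpts c b \<beta>) + card (fixpts b n \<tau>)"
    by (simp add: card_Un_disjoint)
qed

text \<open>Converse of \<open>direct_sum_inv231\<close>. As \<open>\<beta>\<close> is its own
  inverse, composing with it strips the block off, and the involution preserves what lies above the
  invariant block.\<close>

lemma split_off_block:
  assumes b: "\<beta> permutes {c<..b}" "\<And>x. \<beta> (\<beta> x) = x" "card (pat231 \<beta>) = s"
    and p: "\<pi> \<in> inv231 c n (s + j)" and "c \<le> b" "b \<le> n"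
    and eq: "\<And>x. x \<in> {c<..b} \<Longrightarrow> \<pi> x = \<beta> x"
  shows "\<pi> \<in> (\<circ>) \<beta> ` inv231 b n j"
proof -
  have p1: "\<pi> permutes {c<..n}" "\<And>x. \<pi> (\<pi> x) = x" "card (pat231 \<pi>) = s + j"
    using p by (auto simp: inv231_def)
  define \<tau> where "\<tau> = \<beta> \<circ> \<pi>"
  have pt: "\<pi> = \<beta> \<circ> \<tau>" using b(2) by (auto simp: \<tau>_def)
  have low: "\<tau> x = x" if "x \<le> b" for x
    using that eq[of x] b(2)[of x] permutes_not_in[OF p1(1), of x] permutes_not_in[OF b(1), of x]
    by (cases "c < x") (auto simp: \<tau>_def)
  have out: "\<tau> x = \<pi> x \<and> b < \<pi> x" if "b < x" for x
  proof -
    have "b < \<pi> x"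
    proof (rule ccontr)
      assume "\<not> b < \<pi> x"
      then have "\<tau> (\<pi> x) = \<pi> x" using low by simp
      then have "\<beta> x = \<pi> x" using p1(2) by (simp add: \<tau>_def)
      then show False using permutes_not_in[OF b(1), of x] that \<open>\<not> b < \<pi> x\<close> by simp
    qed
    then show ?thesis using permutes_not_in[OF b(1), of "\<pi> x"] by (simp add: \<tau>_def)
  qed
  have inv: "\<tau> (\<tau> x) = x" for x
    using low[of x] out[of x] out[of "\<pi> x"] p1(2) by (cases "x \<le> b") auto
  have t: "\<tau> permutes {b<..n}"
  proof (rule involution_permutes[OF inv])
    fix x assume "x \<notin> {b<..n}"
    then show "\<tau> x = x"
      using low[of x] out[of x] permutes_not_in[OF p1(1), of x] by (cases "x \<le> b") auto
  qed
  have "card (pat231 \<pi>) = s + card (pat231 \<tau>)"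
    using pat231_direct_sum[OF b(1) t] finite_pat231[OF b(1)] finite_pat231[OF t] b(3)
    by (simp add: card_Un_disjoint pt)
  then have "\<tau> \<in> inv231 b n j" using t inv p1(3) by (simp add: inv231_def)
  then show ?thesis using pt by blast
qed

section \<open>The shape of the first block\<close>

lemma decreasing_involution:
  assumes maps: "\<And>x. x \<in> {c<..b} \<Longrightarrow> \<pi> x \<in> {c<..b}" and inv: "\<And>x. \<pi> (\<pi> x) = (x::nat)"
    and dec: "\<And>x y. x \<in> {c<..b} \<Longrightarrow> y \<in> {c<..b} \<Longrightarrow> x < y \<Longrightarrow> \<pi> y < \<pi> x"
    and x: "x \<in> {c<..b}"
  shows "\<pi> x = rev_on c b x"
proof -
  \<comment> \<open>The points after \<open>x\<close> are exactly those with values below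
    \<open>\<pi> x\<close>. Comparing cardinalities gives b - x = \<pi> x - c - 1.\<close>
  have "\<pi> ` {x<..b} = {c<..<\<pi> x}"
  proof (intro subset_antisym subsetI)
    fix y assume "y \<in> \<pi> ` {x<..b}"
    then show "y \<in> {c<..<\<pi> x}" using dec[OF x] maps x by fastforce
  next
    fix y assume y: "y \<in> {c<..<\<pi> x}"
    then have yb: "y \<in> {c<..b}" using maps[OF x] by auto
    have "x < \<pi> y" using dec[OF yb maps[OF x]] y inv by auto
    then show "y \<in> \<pi> ` {x<..b}" using maps[OF yb] inv by (metis greaterThanAtMost_iff image_eqI)
  qed
  moreover have "inj_on \<pi> {x<..b}" by (metis inj_onI inv)
  ultimately have "card {x<..b} = card {c<..<\<pi> x}" by (metis card_image)
  then show ?thesis using x maps[OF x] by (auto simp: rev_on_def)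
qed

lemma first_block:
  assumes p: "\<pi> permutes {c<..n}" and inv: "\<And>x. \<pi> (\<pi> x) = x"
    and one: "card (pat231 \<pi>) \<le> 1" and cn: "c < n"
  obtains b where "b \<in> {c<..n}" "\<And>x. x \<in> {c<..b} \<Longrightarrow> \<pi> x = rev_on c b x"
    | "c + 4 \<le> n" "\<And>x. x \<in> {c<..c+4} \<Longrightarrow> \<pi> x = transpose (c + 1) (c + 4) x"
proof -
  define b where "b = \<pi> (c + 1)"
  have pb: "\<pi> b = c + 1" "\<pi> (c + 1) = b" by (simp_all add: b_def inv)
  have b: "b \<in> {c<..n}" unfolding b_def using permutes_in_image[OF p, of "c + 1"] cn by auto
  have gt: "c < \<pi> x" if "c < x" for x using permutes_interval_gt[OF p] that by simp
  have un: "i = i' \<and> j = j' \<and> l = l'"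
    if "i < j" "j < l" "\<pi> l < \<pi> i" "\<pi> i < \<pi> j" "i' < j'" "j' < l'" "\<pi> l' < \<pi> i'" "\<pi> i' < \<pi> j'"
    for i j l i' j' l'
  proof -
    have "(i, j, l) \<in> pat231 \<pi>" "(i', j', l') \<in> pat231 \<pi>" using that by (auto simp: pat231_def)
    then have "(i, j, l) = (i', j', l')"
      using one card_le_Suc0_iff_eq[OF finite_pat231[OF p]] by (metis One_nat_def)
    then show ?thesis by simp
  qed
  have neq: "\<pi> x \<noteq> \<pi> y" if "x \<noteq> y" for x y using inv that by metis
  have maps: "\<pi> x \<in> {c<..b}" if x: "x \<in> {c<..b}" for x
  proof (rule ccontr)
    assume "\<pi> x \<notin> {c<..b}"
    then have bx: "b < \<pi> x" using gt x by auto
    then have "x \<noteq> c + 1" "x \<noteq> b" using pb b by auto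
    then have "c + 1 < x" "x < b" using x by auto
    then show False
      using un[of "c + 1" x b "c + 1" x "\<pi> x"] bx pb inv[of x] by auto
  qed
  have asc: "\<exists>i j. i \<in> {c<..b} \<and> j \<in> {c<..b} \<and> i < j \<and> \<pi> i < \<pi> j
      \<Longrightarrow> c + 4 \<le> n \<and> (\<forall>x\<in>{c<..c+4}. \<pi> x = transpose (c + 1) (c + 4) x)"
  proof -
    assume "\<exists>i j. i \<in> {c<..b} \<and> j \<in> {c<..b} \<and> i < j \<and> \<pi> i < \<pi> j"
    then obtain i j where ij: "i \<in> {c<..b}" "j \<in> {c<..b}" "i < j" "\<pi> i < \<pi> j" by blast
    have pj: "i \<noteq> c + 1" using ij maps[OF ij(2)] pb by auto
    have jb: "j \<noteq> b" using ij pb maps[OF ij(1)] by auto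
    have low: "c + 1 < \<pi> x" if "x \<in> {c<..b}" "x \<noteq> b" for x
      using maps[OF that(1)] neq[OF that(2)] pb by auto
    \<comment> \<open>Every ascending pair of the block becomes an occurrence when followed by
      \<open>b\<close>, so there is just one such pair.\<close>
    have only: "x = i \<and> y = j" if "x \<in> {c<..b}" "y \<in> {c<..b}" "x < y" "\<pi> x < \<pi> y" for x y
    proof -
      have "y \<noteq> b" using that pb maps[OF that(1)] by auto
      then show ?thesis
        using un[of i j b x y b] ij that jb pb low[of i] low[of x] by auto
    qed
    \<comment> \<open>The pair \<open>(\<pi> i, \<pi> j)\<close> is ascending too, because
      \<open>\<pi>\<close> sends it back to \<open>(i, j)\<close>; by uniqueness the two pairs
      coincide.\<close>
    have fx: "\<pi> i = i" "\<pi> j = j"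
      using only[OF maps[OF ij(1)] maps[OF ij(2)] ij(4)] ij(3) inv by auto
    have in2: "c + 1 < i" "j < b" using ij pj jb by auto
    \<comment> \<open>A further interior point \<open>x\<close> yields a second occurrence, at
      \<open>(i, j, \<pi> x)\<close> if it lies before \<open>i\<close> and at
      \<open>(i, j, x)\<close> if it lies after \<open>j\<close>. Between \<open>i\<close> and
      \<open>j\<close> it would create another ascending pair.\<close>
    have no: "x = i \<or> x = j" if x: "c + 1 < x" "x < b" for x
    proof (rule ccontr)
      assume "\<not> ?thesis"
      then have ne: "x \<noteq> i" "x \<noteq> j" by auto
      have xb: "x \<in> {c<..b}" using x by auto
      have pxb: "\<pi> x < b" using maps[OF xb] neq[of x "c + 1"] pb x by fastforce
      consider "x < i" | "i < x" "x < j" | "j < x" using ne by linarith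
      then show False
      proof cases
        case 1
        have "\<not> \<pi> x < \<pi> j" using only[OF xb ij(2)] 1 ij(3) ne by auto
        then have "j < \<pi> x" using fx neq[of x j] ne by auto
        then show False using un[of i j b i j "\<pi> x"] ij fx inv[of x] 1 pb pxb in2 by auto
      next
        case 2
        then show False using only[OF ij(1) xb] only[OF xb ij(2)] ne ij fx by linarith
      next
        case 3
        have "\<not> \<pi> i < \<pi> x" using only[OF ij(1) xb] 3 ij(3) ne by auto
        then have "\<pi> x < i" using fx neq[of x i] ne by auto
        then show False using un[of i j b i j x] ij fx 3 pb x in2 by auto
      qed
    qed
    \<comment> \<open>The interior of the block is now known to be \<open>{i, j}\<close>, so the
      four points are consecutive.\<close>
    have i2: "i = c + 2"
    proof (rule ccontr)
      assume "i \<noteq> c + 2"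
      then show False using no[of "c + 2"] in2 ij by auto
    qed
    have j2: "j = c + 3"
    proof (rule ccontr)
      assume "j \<noteq> c + 3"
      then show False using no[of "c + 3"] in2 ij i2 by auto
    qed
    have b4: "b = c + 4"
    proof (rule ccontr)
      assume "b \<noteq> c + 4"
      then show False using no[of "c + 4"] in2 i2 j2 by auto
    qed
    have "\<pi> x = transpose (c + 1) (c + 4) x" if "x \<in> {c<..c+4}" for x
    proof -
      have "x = c + 1 \<or> x = c + 2 \<or> x = c + 3 \<or> x = c + 4" using that by auto
      then show ?thesis using pb fx i2 j2 b4 by (auto simp: transpose_def)
    qed
    then show ?thesis using b b4 by auto
  qed
  show thesis
  proof (cases "\<exists>i j. i \<in> {c<..b} \<and> j \<in> {c<..b} \<and> i < j \<and> \<pi> i < \<pi> j")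
    case True
    then show thesis using asc that(2) by blast
  next
    case False
    have "\<pi> x = rev_on c b x" if "x \<in> {c<..b}" for x
    proof (rule decreasing_involution[OF maps inv _ that])
      fix x y assume xy: "x \<in> {c<..b}" "y \<in> {c<..b}" "x < y"
      then have "\<not> \<pi> x < \<pi> y" using False by blast
      then show "\<pi> y < \<pi> x" using neq[of x y] xy(3) by linarith
    qed
    then show thesis using that(1) b by blast
  qed
qed

section \<open>The two kinds of block\<close>

lemma rev_on_involution: "rev_on c b (rev_on c b x) = x"
  by (auto simp: rev_on_def)

lemma rev_on_permutes: "rev_on c b permutes {c<..b}"
  by (rule involution_permutes[OF rev_on_involution]) (auto simp: rev_on_def)

lemma pat231_rev_on: "pat231 (rev_on c b) = {}"
  by (auto simp: pat231_def rev_on_def split: if_splits)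

text \<open>Only the centre (c + b + 1) / 2 can be fixed, and it is an integer exactly when the
  block has odd length.\<close>

lemma card_fixpts_rev_on:
  assumes "c \<le> b" shows "card (fixpts c b (rev_on c b)) = (b - c) mod 2"
proof (cases "even (c + b)")
  case True
  have "fixpts c b (rev_on c b) = {}"
  proof (intro equals0I)
    fix x assume "x \<in> fixpts c b (rev_on c b)"
    then have "c + b + 1 = 2 * x" by (auto simp: fixpts_def rev_on_def)
    then show False using True by presburger
  qed
  then show ?thesis using True assms by simp
next
  case False
  have "fixpts c b (rev_on c b) = {(c + b + 1) div 2}"
    using False assms by (auto simp: fixpts_def rev_on_def elim!: oddE)
  then show ?thesis using False assms by (auto simp: mod2_eq_if)
qed

lemma outer_transposition_permutes: "transpose (c + 1) (c + 4) permutes {c<..c + 4::nat}"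
  by (rule permutes_swap_id) auto

text \<open>This transposition is the block 4231. \<open>pat231_bounds\<close> confines the search
  to its four positions, which leaves a finite check.\<close>

lemma pat231_outer_transposition:
  "pat231 (transpose (c + 1) (c + 4)) = {(c + 2, c + 3, c + 4)}"
proof -
  have "(i, j, l) = (c + 2, c + 3, c + 4)" if m: "(i, j, l) \<in> pat231 (transpose (c + 1) (c + 4))" for i j l
    using m pat231_bounds[OF outer_transposition_permutes m]
    by (auto simp: pat231_def transpose_def split: if_splits)
  moreover have "(c + 2, c + 3, c + 4) \<in> pat231 (transpose (c + 1) (c + 4))"
    by (auto simp: pat231_def transpose_def)
  ultimately show ?thesis
    by (intro set_eqI) (metis prod_cases3 singleton_iff)
qed

lemma card_fixpts_outer_transposition: "card (fixpts c (c + 4) (transpose (c + 1) (c + 4))) = 2"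
proof -
  have "fixpts c (c + 4) (transpose (c + 1) (c + 4)) = {c + 2, c + 3}"
    by (auto simp: fixpts_def transpose_def split: if_splits)
  then show ?thesis by simp
qed

section \<open>Decomposition by the first block\<close>

lemma finite_inv231: "finite (inv231 c n j)"
  by (rule finite_subset[OF _ finite_permutations[of "{c<..n}"]]) (auto simp: inv231_def)

lemma inv231_at_top: "inv231 n n j = (if j = 0 then {id} else {})"
proof -
  have "pat231 id = {}" by (auto simp: pat231_def)
  then show ?thesis by (auto simp: inv231_def)
qed

text \<open>A reversal contains no occurrence and passes the whole count \<open>j\<close> on to the
  rest. The block 4231 uses up the single allowed occurrence, so that the rest avoids 231.\<close>

lemma inv231_decomp:
  assumes "c < n" "j \<le> 1"
  shows "inv231 c n j = (\<Union>b\<in>{c<..n}. (\<circ>) (rev_on c b) ` inv231 b n j) \<union>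
    (if j = 1 \<and> c + 4 \<le> n then (\<circ>) (transpose (c + 1) (c + 4)) ` inv231 (c + 4) n 0 else {})"
    (is "_ = ?R")
proof (intro subset_antisym subsetI)
  fix \<pi> assume p: "\<pi> \<in> inv231 c n j"
  then have p1: "\<pi> permutes {c<..n}" "\<And>x. \<pi> (\<pi> x) = x" "card (pat231 \<pi>) = j"
    by (auto simp: inv231_def)
  have "card (pat231 \<pi>) \<le> 1" using p1(3) assms(2) by simp
  from p1(1,2) this \<open>c < n\<close> show "\<pi> \<in> ?R"
  proof (cases rule: first_block)
    case (1 b)
    have "\<pi> \<in> (\<circ>) (rev_on c b) ` inv231 b n j"
      by (rule split_off_block[OF rev_on_permutes rev_on_involution, where s = 0])
        (use 1 p pat231_rev_on in auto)
    then show ?thesis using 1 by blast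
  next
    case 2
    let ?t = "transpose (c + 1) (c + 4)"
    have q: "(c + 2, c + 3, c + 4) \<in> pat231 \<pi>"
      using 2(2)[of "c + 2"] 2(2)[of "c + 3"] 2(2)[of "c + 4"] by (simp add: pat231_def transpose_def)
    then have j: "j = 1" using p1(3) finite_pat231[OF p1(1)] assms(2) by (cases j) auto
    have "\<pi> \<in> (\<circ>) ?t ` inv231 (c + 4) n 0"
      by (rule split_off_block[OF outer_transposition_permutes, where s = 1])
        (use 2 p j pat231_outer_transposition[of c] in auto)
    then show ?thesis using 2 j by auto
  qed
next
  fix \<pi> assume "\<pi> \<in> ?R"
  then consider b \<tau> where "b \<in> {c<..n}" "\<tau> \<in> inv231 b n j" "\<pi> = rev_on c b \<circ> \<tau>"
    | \<tau> where "j = 1" "c + 4 \<le> n" "\<tau> \<in> inv231 (c + 4) n 0" "\<pi> = transpose (c + 1) (c + 4) \<circ> \<tau>"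
    by (auto split: if_splits)
  then show "\<pi> \<in> inv231 c n j"
  proof cases
    case 1
    have "rev_on c b \<circ> \<tau> \<in> inv231 c n (0 + j)"
      by (rule direct_sum_inv231[OF rev_on_permutes rev_on_involution])
        (use 1 pat231_rev_on in auto)
    then show ?thesis using 1 by simp
  next
    case 2
    have "transpose (c + 1) (c + 4) \<circ> \<tau> \<in> inv231 c n (1 + 0)"
      by (rule direct_sum_inv231[OF outer_transposition_permutes])
        (use 2 pat231_outer_transposition[of c] in auto)
    then show ?thesis using 2 by simp
  qed
qed

section \<open>Recursions for the fixed-point polynomials\<close>

lemma inj_comp_involution:
  assumes "\<And>x. p (p x) = x" shows "inj_on ((\<circ>) p) A"
  by (rule inj_onI) (metis assms comp_apply ext)

lemma fix_poly_rec:
  assumes "c < n" "j \<le> 1"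
  shows "fix_poly c n j = (\<Sum>b\<in>{c<..n}. monom 1 ((b - c) mod 2) * fix_poly b n j) +
    (if j = 1 \<and> c + 4 \<le> n then monom 1 2 * fix_poly (c + 4) n 0 else 0)"
proof -
  let ?w = "\<lambda>\<pi>. monom 1 (card (fixpts c n \<pi>)) :: real poly"
  let ?t = "transpose (c + 1) (c + 4)"
  let ?A = "\<lambda>b. (\<circ>) (rev_on c b) ` inv231 b n j"
  let ?T = "(\<circ>) ?t ` inv231 (c + 4) n 0"
  let ?B = "if j = 1 \<and> c + 4 \<le> n then ?T else {}"
  have A: "sum ?w (?A b) = monom 1 ((b - c) mod 2) * fix_poly b n j" if b: "b \<in> {c<..n}" for b
  proof -
    have "sum ?w (?A b) = (\<Sum>\<tau>\<in>inv231 b n j. ?w (rev_on c b \<circ> \<tau>))"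
      by (subst sum.reindex) (auto intro: inj_comp_involution rev_on_involution)
    also have "\<dots> = (\<Sum>\<tau>\<in>inv231 b n j. monom 1 ((b - c) mod 2) * monom 1 (card (fixpts b n \<tau>)))"
      using b direct_sum_inv231(2)[OF rev_on_permutes rev_on_involution refl]
      by (intro sum.cong) (auto simp: card_fixpts_rev_on mult_monom)
    finally show ?thesis by (simp add: fix_poly_def sum_distrib_left)
  qed
  have T: "sum ?w ?T = monom 1 2 * fix_poly (c + 4) n 0" if n: "c + 4 \<le> n"
  proof -
    have "sum ?w ?T = (\<Sum>\<tau>\<in>inv231 (c + 4) n 0. ?w (?t \<circ> \<tau>))"
      by (subst sum.reindex) (auto intro: inj_comp_involution)
    also have "\<dots> = (\<Sum>\<tau>\<in>inv231 (c + 4) n 0. monom 1 2 * monom 1 (card (fixpts (c + 4) n \<tau>)))"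
      using n direct_sum_inv231(2)[OF outer_transposition_permutes _ refl, of c _ n 0]
        card_fixpts_outer_transposition[of c]
      by (intro sum.cong) (auto simp: mult_monom)
    finally show ?thesis by (simp add: fix_poly_def sum_distrib_left)
  qed
  have first: "\<pi> x = rev_on c b x" if "\<pi> \<in> ?A b" "x \<le> b" for \<pi> x b
    using that direct_sum_eq(1)[OF rev_on_permutes] by (auto simp: inv231_def)
  have firstT: "\<pi> x = ?t x" if "\<pi> \<in> ?T" "x \<le> c + 4" for \<pi> x
    using that direct_sum_eq(1)[OF outer_transposition_permutes] by (auto simp: inv231_def)
  \<comment> \<open>The value at \<open>c + 1\<close> is the last point \<open>b\<close> of the
    block, so different blocks give disjoint families.\<close>
  have dA: "?A b \<inter> ?A b' = {}" if "b \<in> {c<..n}" "b' \<in> {c<..n}" "b \<noteq> b'" for b b'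
  proof (intro equals0I)
    fix \<pi> assume "\<pi> \<in> ?A b \<inter> ?A b'"
    then have "\<pi> (c + 1) = rev_on c b (c + 1)" "\<pi> (c + 1) = rev_on c b' (c + 1)"
      using first[of \<pi> b "c + 1"] first[of \<pi> b' "c + 1"] that by auto
    then show False using that by (simp add: rev_on_def)
  qed
  have dT: "(\<Union>b\<in>{c<..n}. ?A b) \<inter> ?B = {}"
  proof (intro equals0I)
    fix \<pi> assume "\<pi> \<in> (\<Union>b\<in>{c<..n}. ?A b) \<inter> ?B"
    then obtain b where b: "b \<in> {c<..n}" "\<pi> \<in> ?A b" and T: "\<pi> \<in> ?T" by (auto split: if_splits)
    \<comment> \<open>The value at \<open>c + 1\<close> forces a reversal of length 4, but this
      moves \<open>c + 2\<close>, which 4231 fixes.\<close>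
    have "b = c + 4" using first[OF b(2), of "c + 1"] firstT[OF T, of "c + 1"] b(1)
      by (auto simp: rev_on_def transpose_def)
    then show False using first[OF b(2), of "c + 2"] firstT[OF T, of "c + 2"]
      by (auto simp: rev_on_def transpose_def)
  qed
  have "fix_poly c n j = sum ?w ((\<Union>b\<in>{c<..n}. ?A b) \<union> ?B)"
    unfolding fix_poly_def by (subst inv231_decomp[OF assms]) (rule refl)
  also have "\<dots> = sum ?w (\<Union>b\<in>{c<..n}. ?A b) + sum ?w ?B"
    using dT by (intro sum.union_disjoint) (auto simp: finite_inv231)
  also have "sum ?w (\<Union>b\<in>{c<..n}. ?A b) = (\<Sum>b\<in>{c<..n}. sum ?w (?A b))"
    using dA by (intro sum.UNION_disjoint) (auto simp: finite_inv231)
  also have "\<dots> = (\<Sum>b\<in>{c<..n}. monom 1 ((b - c) mod 2) * fix_poly b n j)"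
    by (intro sum.cong refl A)
  also have "sum ?w ?B = (if j = 1 \<and> c + 4 \<le> n then monom 1 2 * fix_poly (c + 4) n 0 else 0)"
    using T by simp
  finally show ?thesis .
qed

lemma fix_poly_at_top: "fix_poly n n j = (if j = 0 then 1 else 0)"
  by (simp add: fix_poly_def inv231_at_top fixpts_def)

text \<open>Instead of conjugating permutations by a translation, the proof compares the recursions
  on both sides; they only involve shorter carriers, to which the induction hypothesis
  applies.\<close>

lemma fix_poly_shift:
  assumes "j \<le> 1" shows "fix_poly c (c + N) j = fix_poly 0 N j"
  using assms
proof (induction N arbitrary: c j rule: less_induct)
  case (less N)
  show ?case
  proof (cases "N = 0")
    case True
    then show ?thesis by (simp add: fix_poly_at_top)
  next
    case False
    have sh: "fix_poly (c + b) (c + N) i = fix_poly 0 (N - b) i" if "0 < b" "b \<le> N" "i \<le> 1" for b c i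
      using less.IH[of "N - b" i "c + b"] that by simp
    have im: "{c<..c + N} = (+) c ` {0<..N}" by simp
    have "(\<Sum>b\<in>{c<..c + N}. monom 1 ((b - c) mod 2) * fix_poly b (c + N) j)
        = (\<Sum>b\<in>{0<..N}. monom 1 (b mod 2) * fix_poly (c + b) (c + N) j)"
      unfolding im by (subst sum.reindex) auto
    also have "\<dots> = (\<Sum>b\<in>{0<..N}. monom 1 ((b - 0) mod 2) * fix_poly b N j)"
    proof (intro sum.cong refl)
      fix b assume "b \<in> {0<..N}"
      then show "monom 1 (b mod 2) * fix_poly (c + b) (c + N) j = monom 1 ((b - 0) mod 2) * fix_poly b N j"
        using sh[of b j c] sh[of b j 0] less.prems by simp
    qed
    finally have "fix_poly c (c + N) j = (\<Sum>b\<in>{0<..N}. monom 1 ((b - 0) mod 2) * fix_poly b N j)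
      + (if j = 1 \<and> 4 \<le> N then monom 1 2 * fix_poly (c + 4) (c + N) 0 else 0)"
      using fix_poly_rec[of c "c + N" j] False less.prems by simp
    also have "fix_poly (c + 4) (c + N) 0 = fix_poly (0 + 4) N 0" if "4 \<le> N"
      using that sh[of 4 0 c] sh[of 4 0 0] by simp
    then have "(if j = 1 \<and> 4 \<le> N then monom 1 2 * fix_poly (c + 4) (c + N) 0 else 0) =
        (if j = 1 \<and> 0 + 4 \<le> N then monom 1 2 * fix_poly (0 + 4) N 0 else 0)"
      by simp
    also have "(\<Sum>b\<in>{0<..N}. monom 1 ((b - 0) mod 2) * fix_poly b N j) + \<dots> = fix_poly 0 N j"
      using False less.prems by (intro fix_poly_rec[symmetric]) auto
    finally show ?thesis .
  qed
qed

lemma fix_poly_rec_0: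
  assumes "0 < N" "j \<le> 1"
  shows "fix_poly 0 N j = (\<Sum>i<N. monom 1 ((N - i) mod 2) * fix_poly 0 i j) +
    (if j = 1 \<and> 4 \<le> N then monom 1 2 * fix_poly 0 (N - 4) 0 else 0)"
proof -
  have sh: "fix_poly b N i = fix_poly 0 (N - b) i" if "0 < b" "b \<le> N" "i \<le> 1" for b i
    using fix_poly_shift[of i b "N - b"] that by simp
  have "(\<Sum>b\<in>{0<..N}. monom 1 ((b - 0) mod 2) * fix_poly b N j)
      = (\<Sum>i<N. monom 1 ((N - i) mod 2) * fix_poly 0 i j)"
  proof (rule sum.reindex_bij_witness[of _ "\<lambda>i. N - i" "\<lambda>b. N - b"])
    fix b assume "b \<in> {0<..N}"
    then show "monom 1 ((N - (N - b)) mod 2) * fix_poly 0 (N - b) j = monom 1 ((b - 0) mod 2) * fix_poly b N j"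
      using sh[of b j] assms(2) by simp
  qed auto
  moreover have "(if j = 1 \<and> 0 + 4 \<le> N then monom 1 2 * fix_poly (0 + 4) N 0 else 0)
      = (if j = 1 \<and> 4 \<le> N then monom 1 2 * fix_poly 0 (N - 4) 0 else 0)"
    using sh[of 4 0] by simp
  ultimately show ?thesis using fix_poly_rec[OF assms] by (simp only:)
qed

text \<open>Subtract the recursion at \<open>N\<close> from that at \<open>N + 2\<close>: block
  weights depend only on parity, so the sums over \<open>i < N\<close> cancel. At
  \<open>N = 0\<close> the sum is empty whereas \<open>fix_poly 0 0 0\<close> is 1, hence the
  correction term.\<close>

lemma fix_poly_Suc_Suc:
  assumes "j \<le> 1"
  shows "fix_poly 0 (N + 2) j = monom 1 1 * fix_poly 0 (N + 1) j + 2 * fix_poly 0 N j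
    - (if N = 0 \<and> j = 0 then 1 else 0)
    + (if j = 1 \<and> 2 \<le> N then monom 1 2 * fix_poly 0 (N - 2) 0 else 0)
    - (if j = 1 \<and> 4 \<le> N then monom 1 2 * fix_poly 0 (N - 4) 0 else 0)"
proof -
  have par: "(\<Sum>i<N. monom 1 ((N + 2 - i) mod 2) * fix_poly 0 i j)
      = (\<Sum>i<N. monom 1 ((N - i) mod 2) * fix_poly 0 i j)"
  proof (intro sum.cong refl)
    fix i assume "i \<in> {..<N}"
    then have "(N + 2 - i) mod 2 = (N - i) mod 2" by (simp add: mod2_eq_if)
    then show "monom 1 ((N + 2 - i) mod 2) * fix_poly 0 i j = monom 1 ((N - i) mod 2) * fix_poly 0 i j"
      by simp
  qed
  have "(\<Sum>i<N + 2. monom 1 ((N + 2 - i) mod 2) * fix_poly 0 i j)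
      = (\<Sum>i<N. monom 1 ((N - i) mod 2) * fix_poly 0 i j) + fix_poly 0 N j
        + monom 1 1 * fix_poly 0 (N + 1) j"
    by (simp add: par[simplified] one_pCons[symmetric] flip: monom_0)
  then show ?thesis
    using fix_poly_rec_0[of "N + 2" j] fix_poly_rec_0[of N j] assms
    by (cases "N = 0") (auto simp: fix_poly_at_top algebra_simps)
qed

section \<open>Coefficients of the fixed-point polynomials\<close>

lemma coeff_fix_poly:
  "coeff (fix_poly c n j) k = real (card {\<pi> \<in> inv231 c n j. card (fixpts c n \<pi>) = k})"
proof -
  have "coeff (fix_poly c n j) k = (\<Sum>\<pi>\<in>inv231 c n j. if card (fixpts c n \<pi>) = k then 1 else 0)"
    by (simp add: fix_poly_def coeff_sum)
  then show ?thesis by (simp add: finite_inv231 flip: sum.inter_filter)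
qed

lemma coeff_fix_poly_eq_0:
  assumes "n < k" shows "coeff (fix_poly 0 n j) k = 0"
proof -
  have "fixpts 0 n \<pi> \<subseteq> {0<..n}" for \<pi> by (auto simp: fixpts_def)
  then have "card (fixpts 0 n \<pi>) \<le> n" for \<pi>
    using card_mono[of "{0<..n}" "fixpts 0 n \<pi>"] by simp
  then have "card (fixpts 0 n \<pi>) \<noteq> k" for \<pi> using assms by (metis not_less)
  then show ?thesis unfolding coeff_fix_poly by simp
qed

text \<open>In every block the length and the number of fixed points have the same parity, and the
  recursion transfers this to sums of blocks.\<close>

lemma coeff_fix_poly_odd:
  assumes "odd (n + k)" "j \<le> 1" shows "coeff (fix_poly 0 n j) k = 0"
  using assms
proof (induction n arbitrary: j k rule: less_induct)
  case (less n)
  show ?case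
  proof (cases "n = 0")
    case True
    then show ?thesis using less.prems by (cases k) (auto simp: fix_poly_at_top)
  next
    case False
    have "coeff (monom 1 ((n - i) mod 2) * fix_poly 0 i j) k = 0" if i: "i < n" for i
    proof (cases "k < (n - i) mod 2")
      case False
      then have "odd (i + (k - (n - i) mod 2))" using less.prems(1) i by (auto simp: mod2_eq_if)
      from less.IH[OF i this less.prems(2)] show ?thesis by (simp add: coeff_monom_mult)
    qed (simp add: coeff_monom_mult)
    moreover have "coeff (monom 1 2 * fix_poly 0 (n - 4) 0) k = 0" if "4 \<le> n"
    proof (cases "k < 2")
      case False
      then have "odd (n - 4 + (k - 2))" using less.prems(1) that by auto
      then show ?thesis using less.IH[of "n - 4" "k - 2" 0] that by (simp add: coeff_monom_mult)
    qed (simp add: coeff_monom_mult)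
    ultimately show ?thesis
      using fix_poly_rec_0[of n j] False less.prems(2) by (simp add: coeff_sum)
  qed
qed

lemma coeff_fix_poly_Suc_Suc:
  assumes "j \<le> 1"
  shows "coeff (fix_poly 0 (N + 2) j) k =
    (if k = 0 then 0 else coeff (fix_poly 0 (N + 1) j) (k - 1)) + 2 * coeff (fix_poly 0 N j) k
    - (if N = 0 \<and> j = 0 \<and> k = 0 then 1 else 0)
    + (if j = 1 \<and> 2 \<le> N \<and> 2 \<le> k then coeff (fix_poly 0 (N - 2) 0) (k - 2) else 0)
    - (if j = 1 \<and> 4 \<le> N \<and> 2 \<le> k then coeff (fix_poly 0 (N - 4) 0) (k - 2) else 0)"
proof -
  have two: "coeff (2 * p) k = 2 * coeff p k" for p :: "real poly"
    unfolding mult_2 coeff_add ..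
  show ?thesis
    by (subst fix_poly_Suc_Suc[OF assms])
      (simp add: coeff_monom_mult two del: One_nat_def)
qed

subsection \<open>Generating functions by number of transpositions\<close>

unbundle fps_syntax

text \<open>The exponent \<open>d\<close> counts transpositions. In this grading, lengths
  \<open>N + 2\<close>, \<open>N + 1\<close>, \<open>N\<close> with \<open>k\<close>,
  \<open>k - 1\<close>, \<open>k\<close> fixed points belong to \<open>d\<close>, \<open>d\<close>,
  \<open>d - 1\<close>, so the two-term recursion becomes multiplication by
  \<open>one_minus_2X\<close>.\<close>

definition fix_series :: "nat \<Rightarrow> nat \<Rightarrow> real fps" where
  "fix_series j k = Abs_fps (\<lambda>d. coeff (fix_poly 0 (k + 2 * d) j) k)"

abbreviation one_minus_2X :: "real fps" where "one_minus_2X \<equiv> 1 - 2 * fps_X"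

lemma fix_poly_0_1:
  assumes "j \<le> 1" shows "fix_poly 0 1 j = monom 1 1 * fix_poly 0 0 j"
  using fix_poly_rec_0[of 1 j] assms by simp

lemma one_minus_2X_nonzero: "one_minus_2X \<noteq> 0"
proof
  assume "one_minus_2X = 0"
  then have "one_minus_2X $ 0 = 0 $ 0" by (rule arg_cong)
  then show False by simp
qed

lemma one_minus_2X_mult_nth:
  "(one_minus_2X * f) $ d = f $ d - (if d = 0 then 0 else 2 * f $ (d - 1))"
proof -
  have "one_minus_2X * f = f - fps_const 2 * (fps_X * f)"
    by (simp add: algebra_simps numeral_fps_const)
  then show ?thesis by (simp only: fps_sub_nth fps_mult_left_const_nth fps_X_mult_nth) simp
qed

lemma fix_series_0_0: "one_minus_2X * fix_series 0 0 = 1 - fps_X"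
proof (rule fps_ext)
  fix d
  show "(one_minus_2X * fix_series 0 0) $ d = (1 - fps_X) $ d"
  proof (cases d)
    case 0
    then show ?thesis by (simp add: one_minus_2X_mult_nth fix_series_def fix_poly_at_top)
  next
    case (Suc e)
    then show ?thesis using coeff_fix_poly_Suc_Suc[of 0 "2 * e" 0]
      by (cases e) (simp_all add: one_minus_2X_mult_nth fix_series_def fix_poly_at_top numeral_2_eq_2)
  qed
qed

lemma fix_series_0_Suc: "one_minus_2X * fix_series 0 (Suc k) = fix_series 0 k"
proof (rule fps_ext)
  fix d
  show "(one_minus_2X * fix_series 0 (Suc k)) $ d = fix_series 0 k $ d"
  proof (cases d)
    \<comment> \<open>At \<open>d = 0\<close> the recursion is used at length \<open>k + 1\<close>;
      the term of length \<open>k - 1\<close> drops out, having too few points for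
      \<open>k + 1\<close> fixed ones. Length 1 is treated separately.\<close>
    case 0
    then show ?thesis
      using coeff_fix_poly_Suc_Suc[of 0 "k - 1" "Suc k"] coeff_fix_poly_eq_0[of "k - 1" "Suc k" 0]
      by (cases k) (simp_all add: one_minus_2X_mult_nth fix_series_def fix_poly_0_1[simplified]
          coeff_monom_mult)
  next
    case (Suc e)
    then show ?thesis using coeff_fix_poly_Suc_Suc[of 0 "Suc k + 2 * e" "Suc k"]
      by (simp add: one_minus_2X_mult_nth fix_series_def)
  qed
qed

text \<open>The block 4231 brings two fixed points, so with fewer of them the recursion has no
  source term and its solution is zero.\<close>

lemma fix_series_1_0: "fix_series 1 0 = 0"
proof -
  have "one_minus_2X * fix_series 1 0 = 0"
  proof (rule fps_ext)
    fix d
    show "(one_minus_2X * fix_series 1 0) $ d = 0 $ d"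
    proof (cases d)
      case 0
      then show ?thesis by (simp add: one_minus_2X_mult_nth fix_series_def fix_poly_at_top)
    next
      case (Suc e)
      then show ?thesis using coeff_fix_poly_Suc_Suc[of 1 "2 * e" 0]
        by (simp add: one_minus_2X_mult_nth fix_series_def)
    qed
  qed
  then show ?thesis using one_minus_2X_nonzero by (metis mult_eq_0_iff)
qed

lemma fix_series_1_1: "fix_series 1 1 = 0"
proof -
  have "one_minus_2X * fix_series 1 1 = fix_series 1 0"
  proof (rule fps_ext)
    fix d
    show "(one_minus_2X * fix_series 1 1) $ d = fix_series 1 0 $ d"
    proof (cases d)
      case 0
      then show ?thesis
        by (simp add: one_minus_2X_mult_nth fix_series_def fix_poly_0_1[simplified] fix_poly_at_top)
    next
      case (Suc e)
      then show ?thesis using coeff_fix_poly_Suc_Suc[of 1 "1 + 2 * e" 1]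
        by (simp add: one_minus_2X_mult_nth fix_series_def)
    qed
  qed
  then show ?thesis using fix_series_1_0 one_minus_2X_nonzero by (metis mult_eq_0_iff)
qed

text \<open>The source terms of lengths \<open>N - 2\<close> and \<open>N - 4\<close> with two fixed
  points fewer have \<open>d - 1\<close> and \<open>d - 2\<close> transpositions, which gives the
  factor X - X^2.\<close>

lemma fix_series_1_Suc_Suc:
  "one_minus_2X * fix_series 1 (k + 2) = fix_series 1 (k + 1) + fps_X * (1 - fps_X) * fix_series 0 k"
proof (rule fps_ext)
  fix d
  have X: "fps_X * (1 - fps_X) * fix_series 0 k = fps_X * (fix_series 0 k - fps_X * fix_series 0 k)"
    by (simp add: algebra_simps)
  show "(one_minus_2X * fix_series 1 (k + 2)) $ d =
      (fix_series 1 (k + 1) + fps_X * (1 - fps_X) * fix_series 0 k) $ d"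
  proof (cases d)
    case 0
    then show ?thesis
      using coeff_fix_poly_Suc_Suc[of 1 k "k + 2"] coeff_fix_poly_eq_0[of k "k + 2" 1]
        coeff_fix_poly_eq_0[of "k - 2" k 0] coeff_fix_poly_eq_0[of "k - 4" k 0]
      unfolding X by (simp add: one_minus_2X_mult_nth fix_series_def)
  next
    case (Suc e)
    show ?thesis
      using coeff_fix_poly_Suc_Suc[of 1 "k + 2 + 2 * e" "k + 2"] coeff_fix_poly_eq_0[of "k + 2 * e - 2" k 0]
      unfolding X Suc by (cases e) (simp_all add: one_minus_2X_mult_nth fix_series_def fps_X_mult_nth)
  qed
qed

lemma fix_series_0_closed: "one_minus_2X ^ Suc k * fix_series 0 k = 1 - fps_X"
proof (induction k)
  case 0
  then show ?case by (simp add: fix_series_0_0)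
next
  case (Suc k)
  have "one_minus_2X ^ Suc (Suc k) * fix_series 0 (Suc k)
      = one_minus_2X ^ Suc k * (one_minus_2X * fix_series 0 (Suc k))"
    by (simp only: power_Suc mult_ac)
  then show ?case using Suc.IH by (simp only: fix_series_0_Suc)
qed

text \<open>After multiplication by the power of \<open>one_minus_2X\<close>, each step of the
  recursion adds the same term X (1 - X)^2, by \<open>fix_series_0_closed\<close>; this produces the
  factor \<open>k\<close>.\<close>

lemma fix_series_1_closed:
  "one_minus_2X ^ Suc k * fix_series 1 (Suc k) = of_nat k * (fps_X * (1 - fps_X)\<^sup>2)"
proof (induction k)
  case 0
  then show ?case by (simp add: fix_series_1_1[simplified])
next
  case (Suc k)
  have "one_minus_2X ^ Suc (Suc k) * fix_series 1 (Suc (Suc k))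
      = one_minus_2X ^ Suc k * (one_minus_2X * fix_series 1 (k + 2))"
    by (simp only: power_Suc mult_ac add_2_eq_Suc')
  also have "\<dots> = one_minus_2X ^ Suc k * fix_series 1 (Suc k)
      + fps_X * (1 - fps_X) * (one_minus_2X ^ Suc k * fix_series 0 k)"
    unfolding fix_series_1_Suc_Suc by (simp only: distrib_left mult_ac Suc_eq_plus1)
  also have "\<dots> = of_nat k * (fps_X * (1 - fps_X)\<^sup>2) + fps_X * (1 - fps_X) * (1 - fps_X)"
    by (simp only: Suc.IH fix_series_0_closed)
  finally show ?case
    by (simp only: of_nat_Suc distrib_right mult_1_left power2_eq_square mult.assoc add.commute)
qed

section \<open>Expansion of the closed forms into binomial coefficients\<close>

definition binom_series :: "nat \<Rightarrow> real fps" where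
  "binom_series k = Abs_fps (\<lambda>d. 2 ^ d * real (d + k choose d))"

text \<open>The negative binomial series of (1 - 2X)^(-k-1); Pascal's rule lowers \<open>k\<close>
  by one for each factor \<open>one_minus_2X\<close>.\<close>

lemma binom_series_inverse: "one_minus_2X ^ Suc k * binom_series k = 1"
proof (induction k)
  case 0
  show ?case
  proof (rule fps_ext)
    fix d show "(one_minus_2X ^ Suc 0 * binom_series 0) $ d = 1 $ d"
      unfolding power_Suc0_right one_minus_2X_mult_nth by (cases d) (simp_all add: binom_series_def)
  qed
next
  case (Suc k)
  have "one_minus_2X * binom_series (Suc k) = binom_series k"
  proof (rule fps_ext)
    fix d show "(one_minus_2X * binom_series (Suc k)) $ d = binom_series k $ d"
    proof (cases d)
      case 0
      then show ?thesis by (simp add: one_minus_2X_mult_nth binom_series_def)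
    next
      case (Suc e)
      have "real (Suc e + Suc k choose Suc e) = real (e + Suc k choose e) + real (Suc e + k choose Suc e)"
        by simp
      then show ?thesis
        unfolding Suc one_minus_2X_mult_nth binom_series_def fps_nth_Abs_fps
        by (simp only: diff_Suc_1 power_Suc distrib_left) simp
    qed
  qed
  moreover have "one_minus_2X ^ Suc (Suc k) * binom_series (Suc k)
      = one_minus_2X ^ Suc k * (one_minus_2X * binom_series (Suc k))"
    by (simp only: power_Suc mult_ac)
  ultimately show ?case using Suc.IH by (simp only:)
qed

lemma fix_series_1_binom:
  "fix_series 1 (Suc k) = of_nat k * (fps_X * ((1 - fps_X)\<^sup>2 * binom_series k))"
proof -
  have "fix_series 1 (Suc k) = fix_series 1 (Suc k) * (one_minus_2X ^ Suc k * binom_series k)"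
    by (simp only: binom_series_inverse mult_1_right)
  also have "\<dots> = (one_minus_2X ^ Suc k * fix_series 1 (Suc k)) * binom_series k"
    by (simp only: mult_ac)
  also have "\<dots> = of_nat k * (fps_X * ((1 - fps_X)\<^sup>2 * binom_series k))"
    unfolding fix_series_1_closed by (simp only: mult.assoc)
  finally show ?thesis .
qed

text \<open>For e >= 2 put M = e + k - 2. By Pascal's rule both sides equal 2^(e-2) (4 C(M,e) + 4
  C(M,e-1) + C(M,e-2)).\<close>

lemma one_minus_X_squared_binom_series:
  assumes "0 < k"
  shows "((1 - fps_X)\<^sup>2 * binom_series k) $ e = 2 powi (int e - 2) *
    (real (int_binomial (int e + int k) (int e))
     + 2 * real (int_binomial (int e + int k - 1) (int e))
     + real (int_binomial (int e + int k - 2) (int e)))" (is "?L = ?R")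
proof -
  obtain m where m: "k = Suc m" using assms by (cases k) auto
  have two: "fps_const 2 = (2 :: real fps)" by (simp add: numeral_fps_const)
  have "(1 - fps_X)\<^sup>2 * binom_series k
      = binom_series k - fps_const 2 * (fps_X * binom_series k) + fps_X * (fps_X * binom_series k)"
    unfolding two by (simp add: algebra_simps power2_eq_square)
  then have L: "?L = binom_series k $ e - 2 * (fps_X * binom_series k) $ e
      + (fps_X * (fps_X * binom_series k)) $ e"
    by (simp only: fps_sub_nth fps_add_nth fps_mult_left_const_nth)
  \<comment> \<open>For \<open>e = 0\<close> and \<open>e = 1\<close> the power of two has a
    negative exponent and some shifted coefficients vanish, so these cases are computed
    directly.\<close>
  consider "e = 0" | "e = 1" | g where "e = g + 2"
    by (metis One_nat_def Suc_1 add.commute add_Suc less_2_cases_iff le_add_diff_inverse2 not_less)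
  then show ?thesis
  proof cases
    case 1
    then show ?thesis unfolding L by (simp add: binom_series_def int_binomial_def power_int_def power2_eq_square)
  next
    case 2
    show ?thesis unfolding L unfolding m 2
      by (cases m) (simp_all add: binom_series_def int_binomial_def power_int_def nat_add_distrib)
  next
    case (3 g)
    have ib: "int_binomial (int a) (int b) = a choose b" for a b
      by (cases "b \<le> a") (auto simp: int_binomial_def)
    have "int e + int k = int (g + m + 3)" "int e + int k - 1 = int (g + m + 2)"
      "int e + int k - 2 = int (g + m + 1)" "int e - 2 = int g" using 3 m by auto
    then have R: "?R = 2 ^ g * (real (g + m + 3 choose (g + 2)) + 2 * real (g + m + 2 choose (g + 2))
        + real (g + m + 1 choose (g + 2)))"
      unfolding 3 by (simp only: ib power_int_of_nat)
    show ?thesis unfolding L unfolding R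
      by (simp add: 3 m binom_series_def algebra_simps eval_nat_numeral)
  qed
qed

subsection \<open>Occurrences as triples of positions\<close>

lemma order_isomorphic_231: "order_isomorphic [x, y, z] [2, 3, 1] \<longleftrightarrow> z < x \<and> x < y"
  by (auto simp: order_isomorphic_def All_less_Suc numeral_2_eq_2)

lemma order_isomorphic_312: "order_isomorphic [x, y, z] [3, 1, 2] \<longleftrightarrow> y < z \<and> z < x"
  by (auto simp: order_isomorphic_def All_less_Suc numeral_2_eq_2)

lemma card_occurrences_triples:
  "card (occurrences n [a, b, c] \<pi>) =
    card {(i, j, l). 0 < i \<and> i < j \<and> j < l \<and> l \<le> n \<and> order_isomorphic [\<pi> i, \<pi> j, \<pi> l] [a, b, c]}"
    (is "_ = card ?T")
proof -
  let ?f = "\<lambda>(i, j, l). {i, j, l}"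
  have sl: "sorted_list_of_set {i, j, l} = [i, j, l]" if "i < j" "j < l" for i j l :: nat
    by (rule sorted_list_of_set_unique[THEN iffD1]) (use that in auto)
  have "occurrences n [a, b, c] \<pi> = ?f ` ?T"
  proof (intro subset_antisym subsetI)
    fix I assume "I \<in> occurrences n [a, b, c] \<pi>"
    then have I: "I \<subseteq> {1..n}" "order_isomorphic (map \<pi> (sorted_list_of_set I)) [a, b, c]"
      by (auto simp: occurrences_def)
    then have fin: "finite I" by (auto intro: finite_subset)
    have "length (sorted_list_of_set I) = 3" using I(2) by (simp add: order_isomorphic_def)
    then obtain i j l where ijl: "sorted_list_of_set I = [i, j, l]"
      by (auto simp: numeral_3_eq_3 length_Suc_conv simp del: length_sorted_list_of_set)
    then have "I = {i, j, l}" using set_sorted_list_of_set[OF fin] by auto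
    moreover have "i < j" "j < l" using strict_sorted_list_of_set[of I] by (auto simp: ijl)
    ultimately have "I = ?f (i, j, l)" "(i, j, l) \<in> ?T" using I by (auto simp: ijl)
    then show "I \<in> ?f ` ?T" by (rule image_eqI)
  next
    fix I assume "I \<in> ?f ` ?T"
    then show "I \<in> occurrences n [a, b, c] \<pi>" by (auto simp: occurrences_def sl)
  qed
  \<comment> \<open>Sorting the index set recovers the triple.\<close>
  moreover have "inj_on ?f ?T"
    by (rule inj_on_inverseI[where g = "\<lambda>I. let s = sorted_list_of_set I in (s ! 0, s ! 1, s ! 2)"])
      (auto simp: sl)
  ultimately show ?thesis by (simp add: card_image)
qed

lemma card_occurrences_231:
  assumes "\<pi> permutes {0<..n}" shows "card (occurrences n [2, 3, 1] \<pi>) = card (pat231 \<pi>)"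
proof -
  have "pat231 \<pi> = {(i, j, l). 0 < i \<and> i < j \<and> j < l \<and> l \<le> n \<and> order_isomorphic [\<pi> i, \<pi> j, \<pi> l] [2, 3, 1]}"
    using pat231_bounds[OF assms] by (fastforce simp: order_isomorphic_231 pat231_def simp del: One_nat_def)
  then show ?thesis by (simp only: card_occurrences_triples)
qed

text \<open>An involution is its own inverse, and inverting turns occurrences of 231 into occurrences of 312.\<close>

lemma card_occurrences_312:
  assumes p: "\<pi> permutes {0<..n}" and inv: "\<And>x. \<pi> (\<pi> x) = x"
  shows "card (occurrences n [3, 1, 2] \<pi>) = card (pat231 \<pi>)"
proof -
  let ?T = "{(i, j, l). 0 < i \<and> i < j \<and> j < l \<and> l \<le> n \<and> order_isomorphic [\<pi> i, \<pi> j, \<pi> l] [3, 1, 2]}"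
  \<comment> \<open>The values of an occurrence of 231, in increasing order, become positions; there
    \<open>\<pi>\<close> takes the values \<open>l\<close>, \<open>i\<close>, \<open>j\<close>,
    which form 312.\<close>
  have "bij_betw (\<lambda>(i, j, l). (\<pi> l, \<pi> i, \<pi> j)) (pat231 \<pi>) ?T"
  proof (rule bij_betwI[where g = "\<lambda>(i, j, l). (\<pi> j, \<pi> l, \<pi> i)"])
    show "(\<lambda>(i, j, l). (\<pi> l, \<pi> i, \<pi> j)) \<in> pat231 \<pi> \<rightarrow> ?T"
    proof (intro Pi_I; clarify)
      fix i j l assume m: "(i, j, l) \<in> pat231 \<pi>"
      then have "0 < i" "i < j" "j < l" "\<pi> l < \<pi> i" "\<pi> i < \<pi> j" "l \<le> n"
        using pat231_bounds[OF p m] by (auto simp: pat231_def)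
      then show "0 < \<pi> l \<and> \<pi> l < \<pi> i \<and> \<pi> i < \<pi> j \<and> \<pi> j \<le> n
          \<and> order_isomorphic [\<pi> (\<pi> l), \<pi> (\<pi> i), \<pi> (\<pi> j)] [3, 1, 2]"
        using permutes_interval_gt[OF p, of l] permutes_interval_le[OF p, of j]
        by (simp add: order_isomorphic_312 inv del: One_nat_def)
    qed
    show "(\<lambda>(i, j, l). (\<pi> j, \<pi> l, \<pi> i)) \<in> ?T \<rightarrow> pat231 \<pi>"
      by (auto simp: order_isomorphic_312 pat231_def inv simp del: One_nat_def)
  qed (auto simp: inv)
  from bij_betw_same_card[OF this] show ?thesis by (simp only: card_occurrences_triples)
qed

section \<open>Transfer to the original counting problem and the final formula\<close>

lemma inv_eq_self_iff:
  assumes "\<pi> permutes S" shows "inv \<pi> = \<pi> \<longleftrightarrow> (\<forall>x. \<pi> (\<pi> x) = x)"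
proof
  assume "inv \<pi> = \<pi>"
  then show "\<forall>x. \<pi> (\<pi> x) = x" using permutes_inverses(1)[OF assms] by simp
next
  assume "\<forall>x. \<pi> (\<pi> x) = x"
  then show "inv \<pi> = \<pi>" by (intro inv_equality) auto
qed

lemma num_inv_once_coeff:
  assumes "\<alpha> \<in> {[2, 3, 1], [3, 1, 2]}"
  shows "real (num_inv_once n k \<alpha>) = coeff (fix_poly 0 n 1) k"
proof -
  have I: "{1..n} = {0<..n}" by auto
  have "card (occurrences n \<alpha> \<pi>) = card (pat231 \<pi>)"
    if "\<pi> permutes {0<..n}" "\<forall>x. \<pi> (\<pi> x) = x" for \<pi>
    using that assms card_occurrences_231[of \<pi> n] card_occurrences_312[of \<pi> n] by auto
  then have "{\<pi> \<in> involutions n. card (fixed_points n \<pi>) = k \<and> contains_exactly_once n \<alpha> \<pi>}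
      = {\<pi> \<in> inv231 0 n 1. card (fixpts 0 n \<pi>) = k}"
    unfolding involutions_def inv231_def fixed_points_def fixpts_def contains_exactly_once_def I
    by (intro Collect_cong) (auto simp: inv_eq_self_iff)
  then show ?thesis unfolding coeff_fix_poly num_inv_once_def by simp
qed

theorem theorem3p5:
  fixes n k :: nat and \<alpha> :: "nat list"
  assumes "\<alpha> \<in> {[2, 3, 1], [3, 1, 2]}" and "n \<ge> 4" and "k \<le> n"
  shows "real (num_inv_once n k \<alpha>) =
    (if even (n + k) then
       (real k - 1) * 2 powi ((int n - int k - 6) div 2) *
         (real (int_binomial ((int n + int k) div 2 - 2) ((int n - int k) div 2 - 1))
          + 2 * real (int_binomial ((int n + int k) div 2 - 3) ((int n - int k) div 2 - 1))
          + real (int_binomial ((int n + int k) div 2 - 4) ((int n - int k) div 2 - 1)))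
     else 0)"
proof (cases "even (n + k)")
  case False
  then show ?thesis using num_inv_once_coeff[OF assms(1)] coeff_fix_poly_odd[of n k 1] by simp
next
  case True
  then have "even (n - k)" using assms(3) by simp
  then obtain d where "n - k = 2 * d" by (elim evenE)
  then have n: "n = k + 2 * d" using assms(3) by simp
  have L: "real (num_inv_once n k \<alpha>) = fix_series 1 k $ d"
    by (simp add: num_inv_once_coeff[OF assms(1)] n fix_series_def)
  have div: "(int n + int k) div 2 = int k + int d" "(int n - int k) div 2 = int d"
    "(int n - int k - 6) div 2 = int d - 3" by (auto simp: n)
  show ?thesis
  \<comment> \<open>Degenerate cases, where both sides vanish: for \<open>k = 1\<close> through the
    factor \<open>k - 1\<close>, for \<open>d = 0\<close> because the lower index is -1, and for
    \<open>k = 0\<close> because the lower index \<open>d - 1\<close> exceeds every upper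
    index.\<close>
  proof (cases "k = 0 \<or> k = 1 \<or> d = 0")
    case True
    then have "fix_series 1 k $ d = 0"
    proof (elim disjE)
      assume "d = 0"
      then show ?thesis using fix_series_1_0 fix_series_1_binom[of "k - 1"] 
        by (cases k) (simp_all add: fps_mult_nth)
    qed (simp_all add: fix_series_1_0[simplified] fix_series_1_1[simplified])
    \<comment> \<open>Here \<open>n \<ge> 4\<close> enters: the lower index \<open>d - 1\<close> is
      positive, so the convention that assigns 1 to lower index 0 does not apply.\<close>
    moreover have "k = 0 \<Longrightarrow> 2 \<le> d" using assms(2) n by simp
    ultimately show ?thesis using True unfolding L div by (auto simp: int_binomial_def)
  next
    case False
    \<comment> \<open>The closed form is indexed by \<open>k - 1\<close>, and its factor X lowers
      \<open>d\<close> by one.\<close>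
    then obtain m e where me: "k = Suc m" "0 < m" "d = Suc e" by (cases k; cases d) auto
    have "fix_series 1 k $ d = real m * (((1 - fps_X)\<^sup>2 * binom_series m) $ e)"
      unfolding me(1,3) fix_series_1_binom
      by (simp only: fps_mult_left_const_nth flip: fps_of_nat) simp
    moreover have "int k + int d - 2 = int e + int m" "int k + int d - 3 = int e + int m - 1"
      "int k + int d - 4 = int e + int m - 2" "int d - 1 = int e" "int d - 3 = int e - 2"
      "real k - 1 = real m" using me by auto
    ultimately show ?thesis
      using \<open>even (n + k)\<close> unfolding L div one_minus_X_squared_binom_series[OF me(2)]
      by (simp only: if_True mult.assoc)
  qed
qed

end
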